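(* Suppose $P$ is a well quasi-ordered poset that is transferable, and $\delta$ is an ordinal. Then $\mathbf{w}(P\times\delta)\ge\mathbf{w}(P)\cdot\delta$ (ordinal product).
   Context: $P\times\delta$ carries the product order, with $\delta$ regarded as a linear order. For a poset $P$ with no infinite antichains (FAC), $\mathbf{w}(P)$ is the rank of the tree of non-empty finite sequences of pairwise incomparable elements ordered by strict initial segment $\sqsubset$ (least ordinal $\gamma$ with some $f$ into $\gamma$ such that $s\sqsubset t\implies f(s)>f(t)$). For $x\in P$ let $\downarrow x=\{y\in P: y\le x\}$. A FAC poset $P$ is transferable if $\mathbf{w}(P\setminus(\downarrow x_1\cup\dots\cup\downarrow x_n))=\mathbf{w}(P)$ for all finitely many $x_1,\dots,x_n\in P$. *)

theory Defs
  imports Main "HOL-Library.Sublist"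
begin

unbundle cardinal_syntax

text \<open>
  A poset is a reflexive order relation \<open>r\<close> with carrier \<open>Field r\<close>, an ordinal is a well-order
  relation taken up to \<open>=o\<close>, and ordinals are compared by \<open>\<le>o\<close>, as in the ordinal library of Main.
  In particular \<open>under r x\<close> is the principal down-set of \<open>x\<close>, and the subposet on a subset \<open>B\<close> of
  the carrier is \<open>Restr r B\<close>.
\<close>

definition incomparable :: "'a rel \<Rightarrow> 'a \<Rightarrow> 'a \<Rightarrow> bool" where
  "incomparable r x y \<longleftrightarrow> (x, y) \<notin> r \<and> (y, x) \<notin> r"

definition antichain :: "'a rel \<Rightarrow> 'a set \<Rightarrow> bool" where
  "antichain r S \<longleftrightarrow> S \<subseteq> Field r \<and> (\<forall>x\<in>S. \<forall>y\<in>S. x \<noteq> y \<longrightarrow> incomparable r x y)"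

definition FAC :: "'a rel \<Rightarrow> bool" where
  "FAC r \<longleftrightarrow> (\<forall>S. antichain r S \<longrightarrow> finite S)"

definition wqo :: "'a rel \<Rightarrow> bool" where
  "wqo r \<longleftrightarrow> Preorder r \<and>
     (\<forall>f :: nat \<Rightarrow> 'a. range f \<subseteq> Field r \<longrightarrow> (\<exists>i j. i < j \<and> (f i, f j) \<in> r))"

definition antichain_seqs :: "'a rel \<Rightarrow> 'a list set" where
  "antichain_seqs r = {s. s \<noteq> [] \<and> set s \<subseteq> Field r \<and> sorted_wrt (incomparable r) s}"

definition rank_function :: "'a rel \<Rightarrow> 'w rel \<Rightarrow> ('a list \<Rightarrow> 'w) \<Rightarrow> bool" where
  "rank_function r W f \<longleftrightarrow>
     (\<forall>s\<in>antichain_seqs r. f s \<in> Field W) \<and>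
     (\<forall>s\<in>antichain_seqs r. \<forall>t\<in>antichain_seqs r. strict_prefix s t \<longrightarrow> (f t, f s) \<in> W - Id)"

definition is_width :: "'a rel \<Rightarrow> 'w rel \<Rightarrow> bool" where
  "is_width r W \<longleftrightarrow> Well_order W \<and> (\<exists>f. rank_function r W f) \<and>
     (\<forall>V :: 'w rel. Well_order V \<longrightarrow> (\<exists>f. rank_function r V f) \<longrightarrow> W \<le>o V)"

text \<open>
  The least ordinal is picked among the well-orders on the type \<open>'a list set\<close>.  This type is large
  enough (\<open>is_width_width\<close>), and the ordinal obtained is least among the suitable well-orders on
  arbitrary types (\<open>is_width_least\<close>).
\<close>

definition width :: "'a rel \<Rightarrow> 'a list set rel" where
  "width r = (SOME W. is_width r W)"

definition transferable :: "'a rel \<Rightarrow> bool" where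
  "transferable r \<longleftrightarrow> Partial_order r \<and> FAC r \<and>
     (\<forall>X. finite X \<longrightarrow> X \<subseteq> Field r \<longrightarrow> width (Restr r (Field r - (\<Union>x\<in>X. under r x))) =o width r)"

definition prod_order :: "'a rel \<Rightarrow> 'b rel \<Rightarrow> ('a \<times> 'b) rel" where
  "prod_order r d = {((x, a), (y, b)). (x, y) \<in> r \<and> (a, b) \<in> d}"

text \<open>The ordinal product \<open>\<alpha> \<cdot> \<beta>\<close> is \<open>\<beta>\<close> copies of \<open>\<alpha>\<close>: the second component is the most significant.\<close>

definition oprod :: "'a rel \<Rightarrow> 'b rel \<Rightarrow> ('a \<times> 'b) rel" (infixr "*o" 80) where
  "r *o d = {((x, a), (y, b)). x \<in> Field r \<and> y \<in> Field r \<and> (a, b) \<in> d \<and> (a = b \<longrightarrow> (x, y) \<in> r)}"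

lemma is_width_least:
  fixes W :: "'w rel" and V :: "'v rel"
  assumes "is_width r W" "Well_order V" "rank_function r V f"
  shows "W \<le>o V"
proof (rule ccontr)
  assume "\<not> W \<le>o V"
  then have "V <o W"
    using assms unfolding is_width_def by (simp add: not_ordLeq_iff_ordLess)
  then have "\<exists>p. Field p < Field W \<and> V =o p \<and> p <o W"
    by (rule iffD1[OF internalize_ordLess])
  then obtain p :: "'w rel" where p: "V =o p" "p <o W"
    by blast
  obtain g where g: "iso V p g" and wp: "Well_order p"
    using p(1) unfolding ordIso_def by auto
  have inj: "inj_on g (Field V)" and im: "g ` Field V = Field p"
    using g assms(2) by (auto simp: iso_def bij_betw_def)
  have mono: "(g a, g b) \<in> p" if "(a, b) \<in> V" for a b
    using g assms(2) wp that embed_compat[of V p g] by (auto simp: iso_def compat_def)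
  have "rank_function r p (g \<circ> f)"
    unfolding rank_function_def
  proof (intro conjI ballI impI)
    fix s assume "s \<in> antichain_seqs r"
    then show "(g \<circ> f) s \<in> Field p"
      using assms(3) im by (auto simp: rank_function_def)
  next
    fix s t assume st: "s \<in> antichain_seqs r" "t \<in> antichain_seqs r" "strict_prefix s t"
    then have "(f t, f s) \<in> V - Id" "f s \<in> Field V" "f t \<in> Field V"
      using assms(3) unfolding rank_function_def by blast+
    then show "((g \<circ> f) t, (g \<circ> f) s) \<in> p - Id"
      using mono inj by (auto dest: inj_onD)
  qed
  then have "W \<le>o p"
    using assms(1) wp unfolding is_width_def by blast
  with p(2) show False
    using not_ordLess_ordLeq by blast
qed

lemma wf_antichain_seqs:
  assumes "Refl r" "FAC r"
  shows "wf {(t, s). s \<in> antichain_seqs r \<and> t \<in> antichain_seqs r \<and> strict_prefix s t}"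
  unfolding wf_iff_no_infinite_down_chain
proof
  assume "\<exists>f. \<forall>i. (f (Suc i), f i) \<in> {(t, s). s \<in> antichain_seqs r \<and> t \<in> antichain_seqs r \<and> strict_prefix s t}"
  then obtain f where f: "\<And>i. f i \<in> antichain_seqs r" "\<And>i. strict_prefix (f i) (f (Suc i))"
    by auto
  have len: "i \<le> length (f i)" for i
  proof (induction i)
    case (Suc i)
    then show ?case
      using prefix_length_less[OF f(2)[of i]] by simp
  qed simp
  have pre: "prefix (f i) (f j)" if "i \<le> j" for i j
    using that
  proof (induction rule: dec_induct)
    case (step n)
    then show ?case
      using f(2)[of n] by (meson prefix_order.less_imp_le prefix_order.trans)
  qed simp
  have pair: "incomparable r x y" if "s \<in> antichain_seqs r" "x \<in> set s" "y \<in> set s" "x \<noteq> y" for s x y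
  proof -
    obtain i j where ij: "i < length s" "j < length s" "x = s ! i" "y = s ! j"
      using \<open>x \<in> set s\<close> \<open>y \<in> set s\<close> unfolding in_set_conv_nth by blast
    with \<open>x \<noteq> y\<close> have "i < j \<or> j < i" by (metis linorder_neqE_nat)
    moreover have "incomparable r (s ! a) (s ! b)" if "a < b" "b < length s" for a b
      using that \<open>s \<in> antichain_seqs r\<close> by (auto simp: antichain_seqs_def sorted_wrt_iff_nth_less)
    ultimately show ?thesis
      using ij by (auto simp: incomparable_def)
  qed
  have dist: "distinct (f i)" for i
    unfolding distinct_conv_nth
  proof (intro allI impI)
    fix a b assume ab: "a < length (f i)" "b < length (f i)" "a \<noteq> b"
    have inc: "incomparable r (f i ! k) (f i ! l)" if "k < l" "l < length (f i)" for k l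
      using that f(1)[of i] by (auto simp: antichain_seqs_def sorted_wrt_iff_nth_less)
    have "f i ! a \<in> Field r"
      using f(1)[of i] ab(1) by (auto simp: antichain_seqs_def)
    then have "(f i ! a, f i ! a) \<in> r"
      using assms(1) by (auto simp: refl_on_def)
    moreover have "incomparable r (f i ! a) (f i ! b) \<or> incomparable r (f i ! b) (f i ! a)"
      using inc[of a b] inc[of b a] ab by (cases "a < b") auto
    ultimately show "f i ! a \<noteq> f i ! b"
      by (auto simp: incomparable_def)
  qed
  let ?S = "\<Union>i. set (f i)"
  have "antichain r ?S"
    unfolding antichain_def
  proof (intro conjI ballI impI)
    show "?S \<subseteq> Field r"
      using f(1) by (auto simp: antichain_seqs_def)
    fix x y assume "x \<in> ?S" "y \<in> ?S" "x \<noteq> y"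
    then obtain i j where "x \<in> set (f i)" "y \<in> set (f j)" by auto
    then have "x \<in> set (f (max i j))" "y \<in> set (f (max i j))"
      using pre[of i "max i j"] pre[of j "max i j"] set_mono_prefix by auto
    then show "incomparable r x y"
      using pair f(1) \<open>x \<noteq> y\<close> by blast
  qed
  then have fin: "finite ?S"
    using assms(2) by (auto simp: FAC_def)
  have "Suc (card ?S) \<le> card (set (f (Suc (card ?S))))"
    using len dist by (simp add: distinct_card)
  also have "\<dots> \<le> card ?S"
    using fin by (intro card_mono) auto
  finally show False by simp
qed

lemma is_width_width:
  fixes r :: "'a rel"
  assumes "Refl r" "FAC r"
  shows "is_width r (width r)"
proof -
  define R where "R = {(t, s). s \<in> antichain_seqs r \<and> t \<in> antichain_seqs r \<and> strict_prefix s t}"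
  have wfR: "wf R"
    unfolding R_def by (rule wf_antichain_seqs[OF assms])
  define k where "k = |UNIV :: 'a list set|"
  define K where "K = cardSuc k"
  have ck: "Card_order k" and ik: "\<not> finite (Field k)"
    unfolding k_def by (rule card_of_Card_order) (simp add: Field_card_of Finite_Set.finite_set infinite_UNIV_listI)
  have cK: "Card_order K" and reg: "regularCard K"
    unfolding K_def using cardSuc_Card_order[OF ck] infinite_cardSuc_regularCard[OF ik ck] .
  have woK: "Well_order K"
    using cK by (rule card_order_on_well_order_on)
  have bound: "\<exists>a\<in>Field K. \<forall>b\<in>A. (b, a) \<in> K - Id"
    if A: "A \<subseteq> Field K" "|A| \<le>o k" for A
  proof -
    have "|A| <o K"
      unfolding K_def using A(2) cardSuc_ordLeq_ordLess[OF ck card_of_Card_order[of A]] by simp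
    then have "\<not> cofinal A K"
      using reg A(1) not_ordLess_ordIso[of "|A|" K] unfolding regularCard_def by auto
    then obtain a where a: "a \<in> Field K" "\<And>b. b \<in> A \<Longrightarrow> a = b \<or> (a, b) \<notin> K"
      unfolding cofinal_def by blast
    have inf: "\<not> finite (Field K)"
      unfolding K_def using cardSuc_finite[OF ck] ik by simp
    obtain c where c: "c \<in> Field K" "a \<noteq> c" "(a, c) \<in> K"
      using infinite_Card_order_limit[OF cK inf a(1)] by blast
    have wr: "wo_rel K"
      using woK by (simp only: wo_rel_def)
    note tot = wo_rel.TOTAL[OF wr] and tr = wo_rel.TRANS[OF wr]
      and as = wo_rel.ANTISYM[OF wr] and re = wo_rel.REFL[OF wr]
    show ?thesis
    proof (intro bexI[of _ c] ballI)
      fix b assume b: "b \<in> A"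
      then have bK: "b \<in> Field K" using A(1) by auto
      have ba: "(b, a) \<in> K"
      proof (cases "a = b")
        case True
        then show ?thesis
          using refl_onD[OF re a(1)] by simp
      next
        case False
        then have "(a, b) \<notin> K"
          using a(2)[OF b] by simp
        then show ?thesis
          using tot[unfolded total_on_def, rule_format, OF a(1) bK False] by simp
      qed
      have "(b, c) \<in> K"
        by (rule transD[OF tr ba c(3)])
      moreover have "b \<noteq> c"
        using antisymD[OF as ba] c(2,3) by auto
      ultimately show "(b, c) \<in> K - Id"
        by simp
    qed (rule c(1))
  qed
  define F where "F = (\<lambda>(g :: 'a list \<Rightarrow> 'a list set) s.
    SOME a. a \<in> Field K \<and> (\<forall>t. (t, s) \<in> R \<longrightarrow> (g t, a) \<in> K - Id))"
  define h where "h = wfrec R F"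
  have step: "h s \<in> Field K \<and> (\<forall>t. (t, s) \<in> R \<longrightarrow> (h t, h s) \<in> K - Id)" for s
    using wfR
  proof (induction s rule: wf_induct_rule)
    case (less s)
    have "|{t. (t, s) \<in> R}| \<le>o |UNIV :: 'a list set|"
      by (rule card_of_mono1) (rule subset_UNIV)
    then have "|h ` {t. (t, s) \<in> R}| \<le>o k"
      unfolding k_def by (rule ordLeq_transitive[OF card_of_image])
    moreover have "h ` {t. (t, s) \<in> R} \<subseteq> Field K"
    proof (intro subsetI, elim imageE)
      fix b t assume "b = h t" "t \<in> {t. (t, s) \<in> R}"
      then show "b \<in> Field K"
        using less.IH[of t] by simp
    qed
    ultimately have "\<exists>a\<in>Field K. \<forall>b\<in>h ` {t. (t, s) \<in> R}. (b, a) \<in> K - Id"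
      by (intro bound)
    then obtain a where a: "a \<in> Field K" "\<forall>b\<in>h ` {t. (t, s) \<in> R}. (b, a) \<in> K - Id"
      by (elim bexE)
    have ex: "\<exists>a. a \<in> Field K \<and> (\<forall>t. (t, s) \<in> R \<longrightarrow> (h t, a) \<in> K - Id)"
      using a by (intro exI[of _ a]) simp
    have "h s = F (cut h R s) s"
      unfolding h_def by (rule wfrec[OF wfR])
    also have "\<dots> = (SOME a. a \<in> Field K \<and> (\<forall>t. (t, s) \<in> R \<longrightarrow> (h t, a) \<in> K - Id))"
      unfolding F_def by (rule arg_cong[where f = Eps]) (simp add: cut_apply cong: imp_cong)
    finally have hs: "h s = (SOME a. a \<in> Field K \<and> (\<forall>t. (t, s) \<in> R \<longrightarrow> (h t, a) \<in> K - Id))" .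
    show ?case
      unfolding hs by (rule someI_ex[OF ex])
  qed
  have "rank_function r K h"
    unfolding rank_function_def
  proof (intro conjI ballI impI)
    fix s t assume "s \<in> antichain_seqs r" "t \<in> antichain_seqs r" "strict_prefix s t"
    then have "(t, s) \<in> R"
      by (simp add: R_def)
    then show "(h t, h s) \<in> K - Id"
      using step by blast
  qed (use step in blast)
  define M :: "'a list set rel set" where "M = {W. Well_order W \<and> (\<exists>f. rank_function r W f)}"
  have "K \<in> M"
    unfolding M_def using woK \<open>rank_function r K h\<close> by blast
  then obtain W where "W \<in> M" "\<forall>V\<in>M. W \<le>o V"
    using exists_minim_Well_order[of M] unfolding M_def by blast
  then have "is_width r W"
    unfolding is_width_def M_def by blast
  then show ?thesis
    unfolding width_def by (rule someI)
qed

end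

theory Submission
  imports Defs "HOL-Library.Infinite_Set"
begin

text \<open>
  Width is the length of a game: one player descends in an ordinal, the other answers each move by
  extending an antichain, and the width is at least \<open>W\<close> iff the second player can answer every
  descent in \<open>W\<close>.  In the game for \<open>w(P) \<cdot> \<delta>\<close> a position \<open>(a, \<gamma>)\<close> is answered by elements
  \<open>(x, \<gamma>)\<close>, where the \<open>x\<close> follow a strategy for \<open>w(P)\<close>.  When the descent drops to a lower level
  \<open>\<beta>\<close>, an element \<open>(y, \<beta>)\<close> is incomparable to everything played so far as soon as \<open>y\<close> lies below
  none of the finitely many first components used.  By transferability the elements \<open>y\<close> with this
  property still have width \<open>w(P)\<close>, so a fresh strategy is available there.
\<close>

section \<open>Preliminaries on well-orders\<close>

lemma Well_orderD:
  assumes "Well_order r"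
  shows "Refl r" "trans r" "antisym r" "wf (r - Id)"
  using assms
  by (simp_all add: well_order_on_def linear_order_on_def partial_order_on_def preorder_on_def)

lemma Well_order_not_less:
  assumes "Well_order r" "a \<in> Field r" "b \<in> Field r" "(b, a) \<notin> r - Id"
  shows "(a, b) \<in> r"
proof -
  have "Total r" "Refl r"
    using assms(1)
    by (simp_all add: well_order_on_def linear_order_on_def partial_order_on_def preorder_on_def)
  then show ?thesis
    using assms(2-) unfolding total_on_def refl_on_def by (cases "a = b") blast+
qed

section \<open>The game of extending antichains\<close>

text \<open>\<open>a\<close> is the ordinal reached by the descent and \<open>s\<close> the
  antichain played so far. Being inductive, the predicate encodes a winning strategy without
  choosing one, and its induction rule is the recursion along a play.\<close>

inductive extendable :: "'a rel \<Rightarrow> 'w rel \<Rightarrow> 'a list \<Rightarrow> 'w \<Rightarrow> bool" for r W where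
  extendableI: "(\<forall>b. (b, a) \<in> W - Id \<longrightarrow>
      (\<exists>x. s @ [x] \<in> antichain_seqs r \<and> extendable r W (s @ [x]) b))
    \<Longrightarrow> extendable r W s a"

text \<open>If \<open>W\<close> were smaller, \<open>h\<close> would map it onto the segment below
  some \<open>v\<close>. In a play from \<open>v\<close>, the rank \<open>h (f s)\<close> can never
  be less than the current position, yet the first rank is already less than
  \<open>v\<close>.\<close>

lemma rank_function_lower_bound:
  assumes V: "Well_order V" and W: "Well_order W" and f: "rank_function r W f"
    and ext: "\<And>v. v \<in> Field V \<Longrightarrow> \<exists>x. [x] \<in> antichain_seqs r \<and> extendable r V [x] v"
  shows "V \<le>o W"
proof (rule ccontr)
  assume "\<not> V \<le>o W"
  then have "W <o V"
    using V W by (simp add: not_ordLeq_iff_ordLess)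
  then obtain v where v: "v \<in> Field V" "W =o Restr V (underS V v)"
    using ordLess_iff_ordIso_Restr[OF V W] by blast
  then obtain h where h: "iso W (Restr V (underS V v)) h"
    unfolding ordIso_def by auto
  have bij: "bij_betw h (Field W) (Field (Restr V (underS V v)))"
    and mono: "\<And>a b. (a, b) \<in> W \<Longrightarrow> (h a, h b) \<in> V"
    using h unfolding iso_iff2 by (auto simp: Field_def)
  have below: "(h a, v) \<in> V - Id" if "a \<in> Field W" for a
    using bij_betwE[OF bij] that by (force simp: Field_def underS_def)
  have strict: "(h a, h b) \<in> V - Id" if "(a, b) \<in> W - Id" for a b
    using that mono[of a b] bij_betw_imp_inj_on[OF bij] by (auto simp: Field_def inj_on_def)
  have antisym: "a = b" if "(a, b) \<in> V" "(b, a) \<in> V" for a b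
    using antisymD[OF Well_orderD(3)[OF V] that] .
  have "(a, h (f s)) \<in> V"
    if "extendable r V s a" "s \<in> antichain_seqs r" "a \<in> Field V" for s a
    using that
  proof (induction rule: extendable.induct)
    case (extendableI a s)
    have fs: "f s \<in> Field W" "h (f s) \<in> Field V"
      using f extendableI.prems(1) below[of "f s"] by (auto simp: rank_function_def Field_def)
    \<comment> \<open>The descent moves to the rank of \<open>s\<close> itself; the answer would
      then have a rank no smaller, although \<open>f\<close> strictly decreases.\<close>
    have False if less: "(h (f s), a) \<in> V - Id"
    proof -
      obtain x where x: "s @ [x] \<in> antichain_seqs r" "(h (f s), h (f (s @ [x]))) \<in> V"
        using extendableI.IH less fs(2) by blast
      have "(f (s @ [x]), f s) \<in> W - Id"
        using f x(1) extendableI.prems(1) unfolding rank_function_def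
        by (metis append_Nil2 same_prefix_prefix strict_prefix_def prefixI not_Cons_self2 same_append_eq)
      then show False
        using strict x(2) antisym by blast
    qed
    then show ?case
      using Well_order_not_less[OF V extendableI.prems(2) fs(2)] by blast
  qed
  moreover obtain x where "[x] \<in> antichain_seqs r" "extendable r V [x] v"
    using ext[OF v(1)] by blast
  ultimately have "(v, h (f [x])) \<in> V" "(h (f [x]), v) \<in> V - Id"
    using v(1) below f by (auto simp: rank_function_def)
  then show False
    using antisym by blast
qed

text \<open>If no first move answers \<open>b\<close>, the least unanswerable moves form a rank
  function into the segment below \<open>b\<close>, against leastness. \<open>W\<close> only has to
  be bounded by the ordinals ranking \<open>r\<close>, so the lemma also serves a subposet with the
  width of the whole poset.\<close>

lemma ex_extendable_singleton:
  fixes W :: "'w rel"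
  assumes W: "Well_order W"
    and least: "\<And>(V :: 'w rel) f. Well_order V \<Longrightarrow> rank_function r V f \<Longrightarrow> W \<le>o V"
    and b: "b \<in> Field W"
  shows "\<exists>x. [x] \<in> antichain_seqs r \<and> extendable r W [x] b"
proof (rule ccontr)
  assume neg: "\<not> ?thesis"
  have wf: "wf (W - Id)"
    using W by (simp add: well_order_on_def)
  have trans: "(x, z) \<in> W - Id" if "(x, y) \<in> W - Id" "(y, z) \<in> W - Id" for x y z
    using that transD[OF Well_orderD(2)[OF W]] antisymD[OF Well_orderD(3)[OF W]] by blast
  \<comment> \<open>\<open>c\<close> is a move that no extension of \<open>s\<close> can answer.
    Taking the least such move makes \<open>\<rho> s\<close> depend on \<open>s\<close>
    alone.\<close>
  define stuck where "stuck s c \<longleftrightarrow> c \<in> Field W \<and>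
    (\<forall>x. s @ [x] \<in> antichain_seqs r \<longrightarrow> \<not> extendable r W (s @ [x]) c)" for s c
  define \<rho> where "\<rho> s = (SOME c. stuck s c \<and> (\<forall>e. (e, c) \<in> W - Id \<longrightarrow> \<not> stuck s e))" for s
  have rho: "stuck s (\<rho> s)" "(\<rho> s, a) \<in> W - Id"
    if not_ext: "\<not> extendable r W s a" and a: "a \<in> Field W" for s a
  proof -
    obtain c where c: "stuck s c" "(c, a) \<in> W - Id"
      using not_ext extendableI[where r = r and W = W and s = s and a = a] unfolding stuck_def by (auto simp: Field_def)
    have "\<exists>c. stuck s c \<and> (\<forall>e. (e, c) \<in> W - Id \<longrightarrow> \<not> stuck s e)"
      using wfE_min[OF wf, of c "Collect (stuck s)"] c(1) by (metis mem_Collect_eq)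
    then have *: "stuck s (\<rho> s) \<and> (\<forall>e. (e, \<rho> s) \<in> W - Id \<longrightarrow> \<not> stuck s e)"
      unfolding \<rho>_def by (rule someI_ex)
    then show "stuck s (\<rho> s)" ..
    have "(\<rho> s, c) \<in> W"
      using * c(1) by (intro Well_order_not_less[OF W]) (auto simp: stuck_def)
    with c(2) show "(\<rho> s, a) \<in> W - Id"
      using trans by blast
  qed
  \<comment> \<open>As \<open>\<rho> s\<close> is unanswerable, \<open>s @ [x]\<close> fails at
    \<open>\<rho> s\<close>, so it has an unanswerable move strictly below.\<close>
  have step: "(\<rho> (s @ [x]), \<rho> s) \<in> W - Id" "stuck (s @ [x]) (\<rho> (s @ [x]))"
    if "stuck s (\<rho> s)" "s @ [x] \<in> antichain_seqs r" for s x
  proof -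
    have "\<not> extendable r W (s @ [x]) (\<rho> s)" "\<rho> s \<in> Field W"
      using that unfolding stuck_def by blast+
    then show "(\<rho> (s @ [x]), \<rho> s) \<in> W - Id" "stuck (s @ [x]) (\<rho> (s @ [x]))"
      using rho by blast+
  qed
  have butlast: "s \<in> antichain_seqs r" if "s @ [x] \<in> antichain_seqs r" "s \<noteq> []" for s x
    using that by (auto simp: antichain_seqs_def sorted_wrt_append)
  have low: "stuck s (\<rho> s) \<and> (\<rho> s, b) \<in> W - Id" if "s \<in> antichain_seqs r" for s
    using that
  proof (induction s rule: rev_induct)
    case (snoc x s)
    show ?case
    proof (cases "s = []")
      case True
      then show ?thesis
        using snoc.prems neg rho[of "[x]" b] b by (metis append_Nil)
    next
      case False
      then show ?thesis
        using snoc butlast[OF snoc.prems False] step[of s x] trans by blast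
    qed
  qed (simp add: antichain_seqs_def)
  have desc: "(\<rho> (s @ u), \<rho> s) \<in> W - Id"
    if "s @ u \<in> antichain_seqs r" "s \<in> antichain_seqs r" "u \<noteq> []" for s u
    using that
  proof (induction u rule: rev_induct)
    case (snoc x u)
    show ?case
    proof (cases "u = []")
      case True
      then show ?thesis
        using snoc.prems step(1)[of s x] low[of s] by simp
    next
      case False
      have su: "s @ u \<in> antichain_seqs r"
        using snoc.prems False butlast[of "s @ u" x] by auto
      then have "(\<rho> (s @ u @ [x]), \<rho> (s @ u)) \<in> W - Id"
        using step(1)[of "s @ u" x] low[of "s @ u"] snoc.prems(1) by simp
      then show ?thesis
        using snoc.IH[OF su snoc.prems(2) False] trans by blast
    qed
  qed simp
  let ?V = "Restr W (underS W b)"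
  have V: "Well_order ?V" "?V <o W"
    using W b by (blast intro: Well_order_Restr underS_Restr_ordLess)+
  have FV: "c \<in> Field ?V" if "(c, b) \<in> W - Id" for c
    using that Well_orderD(1)[OF W] by (auto simp: Field_def underS_def refl_on_def)
  have "rank_function r ?V \<rho>"
    unfolding rank_function_def
  proof (intro conjI ballI impI)
    fix s t assume "s \<in> antichain_seqs r" "t \<in> antichain_seqs r" "strict_prefix s t"
    then show "(\<rho> t, \<rho> s) \<in> ?V - Id"
      using low[of s] low[of t] desc[of s] by (auto simp: strict_prefix_def prefix_def underS_def)
  qed (use low FV in blast)
  then show False
    using least V not_ordLess_ordLeq by blast
qed

section \<open>Finiteness of antichains in restrictions and products\<close>

lemma FAC_Restr:
  assumes "FAC r"
  shows "FAC (Restr r B)"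
  unfolding FAC_def
proof (intro allI impI)
  fix S assume "antichain (Restr r B) S"
  then have "antichain r S"
    by (fastforce simp: antichain_def incomparable_def Field_def)
  then show "finite S"
    using assms by (simp add: FAC_def)
qed

lemma Field_prod_order:
  assumes "Refl r" "Refl d"
  shows "Field (prod_order r d) = Field r \<times> Field d"
  using assms by (fastforce simp: prod_order_def Field_def refl_on_def)

text \<open>An infinite antichain contains a sequence with weakly increasing second components;
  along it the well quasi-order \<open>r\<close> compares two first components in the same
  direction.\<close>

lemma FAC_prod_order:
  fixes r :: "'a rel" and d :: "'d rel"
  assumes r: "wqo r" and d: "Well_order d"
  shows "FAC (prod_order r d)"
  unfolding FAC_def
proof (intro allI impI, rule ccontr)
  fix S assume S: "antichain (prod_order r d) S" and "infinite S"
  then obtain g :: "nat \<Rightarrow> 'a \<times> 'd" where g: "inj g" "range g \<subseteq> S"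
    using infinite_countable_subset by blast
  have fields: "fst (g n) \<in> Field r" "snd (g n) \<in> Field d" for n
  proof -
    have "g n \<in> Field (prod_order r d)"
      using g(2) S by (auto simp: antichain_def)
    then show "fst (g n) \<in> Field r" "snd (g n) \<in> Field d"
      by (auto simp: prod_order_def Field_def)
  qed
  \<comment> \<open>Every tail contributes an index to \<open>G\<close>, namely one where its least
    second component is attained.\<close>
  define G where "G = {m. \<forall>j>m. (snd (g m), snd (g j)) \<in> d}"
  have "\<exists>m>n. m \<in> G" for n
  proof -
    let ?A = "(\<lambda>m. snd (g m)) ` {n<..}"
    obtain z where z: "z \<in> ?A" "\<And>y. (y, z) \<in> d - Id \<Longrightarrow> y \<notin> ?A"
      using wfE_min[OF Well_orderD(4)[OF d], of "snd (g (Suc n))" ?A] by blast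
    then obtain m where m: "m > n" "z = snd (g m)"
      by auto
    have "(snd (g m), snd (g j)) \<in> d" if "j > m" for j
    proof -
      have "(snd (g j), snd (g m)) \<notin> d - Id"
        using z(2)[of "snd (g j)"] m that by (metis greaterThan_iff image_eqI less_trans)
      then show ?thesis
        by (rule Well_order_not_less[OF d fields(2) fields(2)])
    qed
    with m show ?thesis
      unfolding G_def by blast
  qed
  then have G: "infinite G"
    by (auto simp: infinite_nat_iff_unbounded)
  have "range (\<lambda>n. fst (g (enumerate G n))) \<subseteq> Field r"
    using fields by blast
  then obtain i j where ij: "i < j" "(fst (g (enumerate G i)), fst (g (enumerate G j))) \<in> r"
    using r unfolding wqo_def by metis
  let ?x = "g (enumerate G i)" and ?y = "g (enumerate G j)"
  have less: "enumerate G i < enumerate G j"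
    using ij(1) G by (simp add: enumerate_mono)
  then have "(snd ?x, snd ?y) \<in> d"
    using enumerate_in_set[OF G, of i] by (simp add: G_def)
  then have "(?x, ?y) \<in> prod_order r d"
    using ij(2) by (simp add: prod_order_def case_prod_beta)
  moreover have "?x \<noteq> ?y"
    using less g(1) by (auto dest: injD)
  ultimately show False
    using S g(2) unfolding antichain_def incomparable_def by blast
qed

section \<open>The ordinal product\<close>

lemma Field_oprod:
  assumes "Refl r" "Refl d"
  shows "Field (r *o d) = Field r \<times> Field d"
  using assms by (fastforce simp: oprod_def Field_def refl_on_def)

lemma Well_order_oprod:
  assumes r: "Well_order r" and d: "Well_order d"
  shows "Well_order (r *o d)"
proof -
  note r' = Well_orderD[OF r] and d' = Well_orderD[OF d]
  have F: "Field (r *o d) = Field r \<times> Field d"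
    using r'(1) d'(1) by (rule Field_oprod)
  have "Refl (r *o d)"
    using r'(1) d'(1) unfolding refl_on_def F by (auto simp: oprod_def)
  moreover have "trans (r *o d)"
  proof (rule transI)
    fix p q s assume "(p, q) \<in> r *o d" "(q, s) \<in> r *o d"
    then show "(p, s) \<in> r *o d"
      using transD[OF r'(2)] transD[OF d'(2)] antisymD[OF d'(3)]
      by (auto simp: oprod_def)
  qed
  moreover have "antisym (r *o d)"
  proof (rule antisymI)
    fix p q assume "(p, q) \<in> r *o d" "(q, p) \<in> r *o d"
    then show "p = q"
      using antisymD[OF r'(3)] antisymD[OF d'(3)] by (auto simp: oprod_def)
  qed
  moreover have "Total (r *o d)"
    unfolding total_on_def F
  proof (intro ballI impI)
    fix p q assume "p \<in> Field r \<times> Field d" "q \<in> Field r \<times> Field d" "p \<noteq> q"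
    then show "(p, q) \<in> r *o d \<or> (q, p) \<in> r *o d"
      using Well_order_not_less[OF r, of "fst p" "fst q"] Well_order_not_less[OF d, of "snd p" "snd q"]
      by (cases p; cases q) (auto simp: oprod_def)
  qed
  moreover have "wf (r *o d - Id)"
  proof (rule wf_subset)
    \<comment> \<open>\<open>prod.swap\<close> puts the more significant component first.\<close>
    show "wf (inv_image ((d - Id) <*lex*> (r - Id)) prod.swap)"
      using r'(4) d'(4) by (intro wf_inv_image wf_lex_prod)
  qed (auto simp: oprod_def inv_image_def)
  moreover have "r *o d \<subseteq> Field (r *o d) \<times> Field (r *o d)"
    by (auto simp: Field_def)
  ultimately show ?thesis
    unfolding well_order_on_def linear_order_on_def partial_order_on_def preorder_on_def
    by simp
qed

section \<open>The game on the product order\<close>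

text \<open>Any ordinal ranking the remaining subposet is at least its width, which transferability
  equates with \<open>width r\<close>. This supplies the fresh strategy after each drop.\<close>

lemma transferable_ex_extendable:
  assumes t: "transferable r" and X: "finite X" "X \<subseteq> Field r" and b: "b \<in> Field (width r)"
  shows "\<exists>x. [x] \<in> antichain_seqs (Restr r (Field r - (\<Union>x\<in>X. under r x))) \<and>
    extendable (Restr r (Field r - (\<Union>x\<in>X. under r x))) (width r) [x] b"
proof (rule ex_extendable_singleton[OF _ _ b])
  let ?r = "Restr r (Field r - (\<Union>x\<in>X. under r x))"
  have r: "Refl r" "FAC r"
    using t by (auto simp: transferable_def partial_order_on_def preorder_on_def)
  show "Well_order (width r)"
    using is_width_width[OF r] by (simp add: is_width_def)
  have "Refl ?r"
    using r(1) by (auto simp: refl_on_def Field_def)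
  then have w: "is_width ?r (width ?r)"
    using FAC_Restr[OF r(2)] is_width_width by blast
  have iso: "width ?r =o width r"
    using t X by (auto simp: transferable_def)
  fix V :: "'a list set rel" and f assume "Well_order V" "rank_function ?r V f"
  then show "width r \<le>o V"
    using w iso unfolding is_width_def by (meson ordIso_ordLeq_trans ordIso_symmetric)
qed

text \<open>An element on a lower level can only lie below the elements of \<open>u\<close>.\<close>

lemma antichain_seqs_append_level:
  fixes r :: "'a rel" and d :: "'d rel"
  assumes r: "Refl r" and d: "Refl d" "antisym d"
    and s: "s \<in> antichain_seqs (Restr r (Field r - (\<Union>x\<in>fst ` set u. under r x)))"
    and u: "set u \<subseteq> Field r \<times> Field d" "sorted_wrt (incomparable (prod_order r d)) u"
    and level: "\<And>p. p \<in> set u \<Longrightarrow> (\<gamma>, snd p) \<in> d - Id" "\<gamma> \<in> Field d"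
  shows "u @ map (\<lambda>x. (x, \<gamma>)) s \<in> antichain_seqs (prod_order r d)"
proof -
  have s': "s \<noteq> []" "set s \<subseteq> Field r - (\<Union>x\<in>fst ` set u. under r x)"
    using s unfolding antichain_seqs_def by (auto simp: Field_def)
  have "sorted_wrt (incomparable (Restr r (Field r - (\<Union>x\<in>fst ` set u. under r x)))) s"
    using s by (simp add: antichain_seqs_def)
  then have "sorted_wrt (incomparable r) s"
    by (rule sorted_wrt_mono_rel[rotated]) (use s'(2) in \<open>auto simp: incomparable_def\<close>)
  then have "sorted_wrt (incomparable (prod_order r d)) (map (\<lambda>x. (x, \<gamma>)) s)"
    unfolding sorted_wrt_map
    by (rule sorted_wrt_mono_rel[rotated]) (auto simp: incomparable_def prod_order_def)
  \<comment> \<open>The first components prevent \<open>(x, \<gamma>)\<close> from lying below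
    \<open>p\<close>, the levels prevent the converse.\<close>
  moreover have "incomparable (prod_order r d) p (x, \<gamma>)" if "p \<in> set u" "x \<in> set s" for p x
  proof -
    have "x \<notin> under r (fst p)"
      using that s'(2) by blast
    moreover have "(snd p, \<gamma>) \<notin> d"
      using level(1)[OF that(1)] antisymD[OF d(2)] by blast
    ultimately show ?thesis
      by (cases p) (simp add: incomparable_def prod_order_def under_def)
  qed
  ultimately show ?thesis
    using s' u level(2) r d(1)
    by (auto simp: antichain_seqs_def sorted_wrt_append Field_prod_order)
qed

text \<open>\<open>u\<close> is the history on higher levels, \<open>s\<close> the play on level
  \<open>\<gamma>\<close>. The outer induction on \<open>\<gamma>\<close> handles drops, with
  \<open>u\<close>, \<open>s\<close>, \<open>a\<close> arbitrary because a drop turns everything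
  played into history; the inner induction follows the current strategy on a fixed level.\<close>

lemma extendable_prod_order:
  fixes r :: "'a rel" and d :: "'d rel"
  assumes t: "transferable r" and d: "Well_order d"
    and "\<gamma> \<in> Field d"
    and "set u \<subseteq> Field r \<times> Field d" "sorted_wrt (incomparable (prod_order r d)) u"
    and "\<And>p. p \<in> set u \<Longrightarrow> (\<gamma>, snd p) \<in> d - Id"
    and "s \<in> antichain_seqs (Restr r (Field r - (\<Union>x\<in>fst ` set u. under r x)))"
    and "extendable (Restr r (Field r - (\<Union>x\<in>fst ` set u. under r x))) (width r) s a"
  shows "extendable (prod_order r d) (width r *o d) (u @ map (\<lambda>x. (x, \<gamma>)) s) (a, \<gamma>)"
proof -
  have r: "Refl r"
    using t by (simp add: transferable_def partial_order_on_def preorder_on_def)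
  note reflo = Well_orderD(1)[OF d] and transo = Well_orderD(2)[OF d]
    and antio = Well_orderD(3)[OF d] and wfo = Well_orderD(4)[OF d]
  show ?thesis
    using wfo assms(3-)
  proof (induction \<gamma> arbitrary: u s a rule: wf_induct_rule)
    case (less \<gamma>)
    note level_IH = less.IH and u = less.prems(1-4)
    let ?r = "Restr r (Field r - (\<Union>x\<in>fst ` set u. under r x))"
    show ?case
      using less.prems(6) less.prems(5)
    proof (induction rule: extendable.induct)
      case (extendableI a s)
      let ?v = "u @ map (\<lambda>x. (x, \<gamma>)) s"
      have v: "?v \<in> antichain_seqs (prod_order r d)"
        using antichain_seqs_append_level[OF r reflo antio extendableI.prems u(2,3) _ u(1)] u(4) by blast
      have vF: "set ?v \<subseteq> Field r \<times> Field d" "sorted_wrt (incomparable (prod_order r d)) ?v"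
        using v r reflo by (auto simp: antichain_seqs_def Field_prod_order)
      show ?case
      proof (rule extendable.extendableI, intro allI impI)
        fix q assume q: "(q, a, \<gamma>) \<in> width r *o d - Id"
        obtain b \<beta> where q_eq: "q = (b, \<beta>)" by fastforce
        have b: "b \<in> Field (width r)" "(\<beta>, \<gamma>) \<in> d"
          and same: "\<beta> = \<gamma> \<Longrightarrow> (b, a) \<in> width r - Id"
          using q by (auto simp: q_eq oprod_def)
        show "\<exists>p. ?v @ [p] \<in> antichain_seqs (prod_order r d) \<and>
            extendable (prod_order r d) (width r *o d) (?v @ [p]) q"
        proof (cases "\<beta> = \<gamma>")
          case True
          then obtain x where x: "s @ [x] \<in> antichain_seqs ?r"
            "extendable (prod_order r d) (width r *o d) (u @ map (\<lambda>x. (x, \<gamma>)) (s @ [x])) (b, \<gamma>)"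
            using extendableI.IH same by blast
          moreover have "u @ map (\<lambda>x. (x, \<gamma>)) (s @ [x]) \<in> antichain_seqs (prod_order r d)"
            using antichain_seqs_append_level[OF r reflo antio x(1) u(2,3) _ u(1)] u(4) by blast
          ultimately show ?thesis
            using True q_eq by (intro exI[of _ "(x, \<gamma>)"]) simp
        next
          case False
          then have \<beta>: "(\<beta>, \<gamma>) \<in> d - Id" "\<beta> \<in> Field d"
            using b(2) by (auto simp: Field_def)
          have below: "(\<beta>, snd p) \<in> d - Id" if "p \<in> set ?v" for p
          proof -
            \<comment> \<open>Only weak: the elements coming from \<open>s\<close> lie exactly on
              level \<open>\<gamma>\<close>.\<close>
            have "(\<gamma>, snd p) \<in> d"
              using that u(1) reflo by (auto simp: refl_on_def dest!: u(4))
            then show ?thesis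
              using \<beta>(1) transo antio by (auto dest: transD antisymD)
          qed
          \<comment> \<open>After a drop \<open>b\<close> may exceed \<open>a\<close>, so the old
            strategy is of no help and a new one is started outside the down-sets of all first
            components used.\<close>
          have "finite (fst ` set ?v)" "fst ` set ?v \<subseteq> Field r"
            using vF(1) by auto
          then obtain x where x:
            "[x] \<in> antichain_seqs (Restr r (Field r - (\<Union>x\<in>fst ` set ?v. under r x)))"
            "extendable (Restr r (Field r - (\<Union>x\<in>fst ` set ?v. under r x))) (width r) [x] b"
            using transferable_ex_extendable[OF t _ _ b(1)] by blast
          have "?v @ map (\<lambda>x. (x, \<beta>)) [x] \<in> antichain_seqs (prod_order r d)"
            using antichain_seqs_append_level[OF r reflo antio x(1) vF _ \<beta>(2)] below by blast
          moreover have "extendable (prod_order r d) (width r *o d) (?v @ map (\<lambda>x. (x, \<beta>)) [x]) (b, \<beta>)"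
            using level_IH[OF \<beta>(1,2) vF below x] .
          ultimately show ?thesis
            using q_eq by (intro exI[of _ "(x, \<beta>)"]) simp
        qed
      qed
    qed
  qed
qed

theorem theorem4p16:
  fixes r :: "'a rel" and d :: "'d rel"
  assumes "Partial_order r"
    and "wqo r"
    and "transferable r"
    and "Well_order d"
  shows "width r *o d \<le>o width (prod_order r d)"
proof -
  have r: "Refl r" "FAC r"
    using assms(3) by (simp_all add: transferable_def partial_order_on_def preorder_on_def)
  note d = Well_orderD(1,3)[OF assms(4)]
  have W: "Well_order (width r)"
    using is_width_width[OF r] by (simp add: is_width_def)
  note W' = Well_orderD(1)[OF W]
  have "Refl (prod_order r d)"
    unfolding refl_on_def Field_prod_order[OF r(1) d(1)]
    using r(1) d(1) by (auto simp: prod_order_def refl_on_def)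
  \<comment> \<open>The well quasi-order hypothesis makes the antichains of the product finite, so
    its \<open>width\<close> is a genuine least ordinal.\<close>
  then have w: "is_width (prod_order r d) (width (prod_order r d))"
    using FAC_prod_order[OF assms(2,4)] is_width_width by blast
  then obtain f where f: "rank_function (prod_order r d) (width (prod_order r d)) f"
    and wo: "Well_order (width (prod_order r d))"
    unfolding is_width_def by blast
  show ?thesis
  proof (rule rank_function_lower_bound[OF Well_order_oprod[OF W assms(4)] wo f])
    fix v assume "v \<in> Field (width r *o d)"
    then obtain b \<beta> where v: "v = (b, \<beta>)" "b \<in> Field (width r)" "\<beta> \<in> Field d"
      using Field_oprod[OF W' d(1)] by auto
    \<comment> \<open>The play opens with an empty history, so no down-set is removed yet.\<close>
    let ?u = "[] :: ('a \<times> 'd) list"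
    obtain x where x:
      "[x] \<in> antichain_seqs (Restr r (Field r - (\<Union>x\<in>fst ` set ?u. under r x)))"
      "extendable (Restr r (Field r - (\<Union>x\<in>fst ` set ?u. under r x))) (width r) [x] b"
      using transferable_ex_extendable[OF assms(3) _ _ v(2), of "fst ` set ?u"] by auto
    have "?u @ map (\<lambda>x. (x, \<beta>)) [x] \<in> antichain_seqs (prod_order r d)"
      using antichain_seqs_append_level[OF r(1) d x(1) _ _ _ v(3)] by simp
    moreover have "extendable (prod_order r d) (width r *o d) (?u @ map (\<lambda>x. (x, \<beta>)) [x]) v"
      unfolding v(1) using extendable_prod_order[OF assms(3,4) v(3) _ _ _ x] by simp
    ultimately show "\<exists>p. [p] \<in> antichain_seqs (prod_order r d) \<and>
        extendable (prod_order r d) (width r *o d) [p] v"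
      by auto
  qed
qed

end
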